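(* Consider the following time-allocation model. Task durations $X_1,X_2,\dots$ are i.i.d. copies of a random variable $X$ with values in $[0,C]$, $C>0$. A measurable reward function $r:[0,C]\to[E,D]$ with $E\le0\le D$ is given. Idle times $S_1,S_2,\dots$ are i.i.d. exponential with parameter $\lambda>0$, independent of the durations. At step $n$ the agent waits $S_n$, then observes $X_n$ and takes a decision $a_n\in\{0,1\}$ (reject/accept); if she accepts, she is busy for time $X_n$ and earns a reward $Y_n$ with $\mathbb{E}[Y_n\mid X_n]=r(X_n)$. Let $\mathcal{T}_n=\sum_{i=1}^n (S_i+X_ia_i)$, $\theta=\min\{n\in\mathbb{N}:\mathcal{T}_n>T\}$, and $t_n=S_n+\sum_{i=1}^{n-1}(S_i+X_ia_i)$. A policy $\pi$ is a map that, given the proposed task $X_n$, the time $t_n$ and the history $\mathcal{H}_{t_n}=(X_i,Y_ia_i)_{i:\mathcal{T}_i<t_n}$, returns $a_n=\pi(X_n,t_n,\mathcal{H}_{t_n})\in\{0,1\}$; its expected reward is $U_\pi(T)=\mathbb{E}\big[\sum_{n=1}^{\theta} r(X_n)\,\pi(X_n,t_n,\mathcal{H}_{t_n})\big]$. Let $c^*$ be the unique root on $\mathbb{R}_+$ of $\Phi(c)=\lambda\,\mathbb{E}[(r(X)-cX)_+]-c$. Then the policy $\pi^*$ which accepts a task of duration $x$ if and only if $r(x)\ge c^*x$ satisfies $U_{\pi^*}(T)\ge \sup_\pi U_\pi(T)-c^*C$.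
   Context: $(z)_+=\max\{z,0\}$. The supremum is over all policies as defined in the claim. *)

theory Defs
  imports "HOL-Probability.Probability"
begin

text \<open>A sample point: for each step n (0-indexed) a triple (S n, X n, Y n) of
  idle time, task duration and reward (the reward is only observed if accepted).\<close>

type_synonym sample = "nat \<Rightarrow> real \<times> real \<times> real"

text \<open>A policy: given the step index n, the proposed duration X n, the current time t n
  and the history (X i, Y i * a i) for i < n (padded with (0,0) for i \<ge> n), decide.\<close>

type_synonym policy = "nat \<Rightarrow> real \<Rightarrow> real \<Rightarrow> (nat \<Rightarrow> real \<times> real) \<Rightarrow> bool"

definition So :: "sample \<Rightarrow> nat \<Rightarrow> real" where "So \<omega> i = fst (\<omega> i)"
definition Xo :: "sample \<Rightarrow> nat \<Rightarrow> real" where "Xo \<omega> i = fst (snd (\<omega> i))"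
definition Yo :: "sample \<Rightarrow> nat \<Rightarrow> real" where "Yo \<omega> i = snd (snd (\<omega> i))"

definition step_measure :: "real \<Rightarrow> (real \<times> real) measure \<Rightarrow> (real \<times> real \<times> real) measure" where
  "step_measure l \<nu> = density lborel (exponential_density l) \<Otimes>\<^sub>M \<nu>"

definition Omega :: "real \<Rightarrow> (real \<times> real) measure \<Rightarrow> sample measure" where
  "Omega l \<nu> = (\<Pi>\<^sub>M i\<in>(UNIV::nat set). step_measure l \<nu>)"

fun decs :: "policy \<Rightarrow> sample \<Rightarrow> nat \<Rightarrow> nat \<Rightarrow> bool" where
  "decs \<pi> \<omega> 0 = (\<lambda>_. False)"
| "decs \<pi> \<omega> (Suc n) =
     (let d = decs \<pi> \<omega> n;
          t = (\<Sum>i<n. So \<omega> i + Xo \<omega> i * of_bool (d i)) + So \<omega> n;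
          h = (\<lambda>i. if i < n then (Xo \<omega> i, if d i then Yo \<omega> i else 0) else (0, 0))
      in d(n := \<pi> n (Xo \<omega> n) t h))"

definition act :: "policy \<Rightarrow> sample \<Rightarrow> nat \<Rightarrow> bool" where
  "act \<pi> \<omega> n = decs \<pi> \<omega> (Suc n) n"

text \<open>Time elapsed at the end of step k (this is T_{k+1} in 1-indexed notation).\<close>
definition busy :: "policy \<Rightarrow> sample \<Rightarrow> nat \<Rightarrow> real" where
  "busy \<pi> \<omega> k = (\<Sum>i\<le>k. So \<omega> i + Xo \<omega> i * of_bool (act \<pi> \<omega> i))"

definition theta :: "policy \<Rightarrow> real \<Rightarrow> sample \<Rightarrow> nat" where
  "theta \<pi> T \<omega> = (LEAST k. busy \<pi> \<omega> k > T)"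

definition total_reward :: "policy \<Rightarrow> (real \<Rightarrow> real) \<Rightarrow> real \<Rightarrow> sample \<Rightarrow> real" where
  "total_reward \<pi> r T \<omega> = (\<Sum>k\<le>theta \<pi> T \<omega>. r (Xo \<omega> k) * of_bool (act \<pi> \<omega> k))"

definition U :: "real \<Rightarrow> (real \<times> real) measure \<Rightarrow> (real \<Rightarrow> real) \<Rightarrow> real \<Rightarrow> policy \<Rightarrow> real" where
  "U l \<nu> r T \<pi> = (\<integral>\<omega>. total_reward \<pi> r T \<omega> \<partial>Omega l \<nu>)"

definition admissible :: "policy \<Rightarrow> bool" where
  "admissible \<pi> \<longleftrightarrow> (\<forall>n. (\<lambda>(x, t, h). \<pi> n x t h) \<in>
      measurable (borel \<Otimes>\<^sub>M borel \<Otimes>\<^sub>M (\<Pi>\<^sub>M i\<in>(UNIV::nat set). (borel \<Otimes>\<^sub>M borel))) (count_space UNIV))"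

definition Phi :: "real \<Rightarrow> (real \<times> real) measure \<Rightarrow> (real \<Rightarrow> real) \<Rightarrow> real \<Rightarrow> real" where
  "Phi l \<nu> r c = l * (\<integral>p. max (r (fst p) - c * fst p) 0 \<partial>\<nu>) - c"

end

(*
  Let R be the time left before a step. A policy's reward plus a potential f(R), with f = 0 once
  R < 0, is a supermartingale (submartingale) if f dominates (is dominated by) its one-step Bellman
  operator, and then its expected reward is at most (at least) f(T). Write A for the event
  r(X) >= c*X with c = c*. The function c*s + max(E[r(X)+], c*C) is a supersolution for every policy.
  If E[r(X)+] <= c*C, the subsolution c*s suffices for the threshold policy. Otherwise one needs to
  account for the last task, which may be proposed after time T and is still rewarded: the
  subsolution is then c*s + E[r(X); A] - c*P(A)*min(s, C), and
  E[r(X)+] - E[r(X); A] <= c*C*(1 - P(A)).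
*)

theory Submission
  imports Defs
begin

text \<open>Why linear potentials: for an exponential idle time S, the mean of
  \<open>f + f' / l\<close> at \<open>s - S\<close> over S \<le> s returns \<open>f s\<close> up to
  a multiple of \<open>exp (- l * s)\<close>. Slope \<open>c\<close> thus balances inside the
  horizon exactly when the mean positive part of r(X) - c X is \<open>c / l\<close>, which is the
  root equation. Two boundary effects remain. A task proposed after the horizon contributes
  \<open>exp (- l * s)\<close> times (its mean reward minus the potential at 0). An accepted task
  that overruns drops the potential to 0 instead of following its linear continuation. A large value
  at 0 helps an upper bound on both counts. For a lower bound the two effects conflict: matching the
  last reward at 0 creates a jump that overruns then lose, and flattening the potential below
  \<open>C\<close> pays for it. Because of the jump the Bellman operator is never evaluated exactly;
  an explicit integrand \<open>Q\<close> bounds it on the required side.\<close>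

section \<open>An integral identity for exponential idle times\<close>

text \<open>With \<open>g\<close> the derivative of \<open>f\<close>, the integrand times the
  density on {0..s} is the derivative in x of \<open>- exp (- x * l) * f (s - x)\<close>. The event
  x > s has mass \<open>exp (- l * s)\<close> and carries the constant \<open>\<rho>\<close>. The
  exceptional set \<open>N\<close> allows potentials with kinks.\<close>

lemma exponential_integral_potential:
  fixes f g :: "real \<Rightarrow> real"
  assumes l: "0 < l" and s: "0 \<le> s" and N: "finite N"
    and cont: "continuous_on UNIV f"
    and deriv: "\<And>u. u \<notin> N \<Longrightarrow> (f has_real_derivative g u) (at u)"
    and g: "g \<in> borel_measurable borel" "\<And>u. \<bar>g u\<bar> \<le> B"
  shows "(\<integral>x. (if x \<le> s then f (s - x) + g (s - x) / l else \<rho>)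
      \<partial>density lborel (exponential_density l)) = f s + exp (- l * s) * (\<rho> - f 0)"
proof -
  define h where "h x = l * exp (- x * l) * (f (s - x) + g (s - x) / l)" for x
  have [measurable]: "f \<in> borel_measurable borel"
    using cont by (rule borel_measurable_continuous_onI)
  note g(1)[measurable]
  interpret Ex: prob_space "density lborel (exponential_density l)"
    using l by (rule prob_space_exponential_density)
  have hi: "(h has_integral (- exp (- s * l) * f 0 - (- exp (- 0 * l) * f (s - 0)))) {0..s}"
  proof -
    have "(h has_integral ((\<lambda>x. - exp (- x * l) * f (s - x)) s - (\<lambda>x. - exp (- x * l) * f (s - x)) 0)) {0..s}"
    proof (rule fundamental_theorem_of_calculus_strong[of "(\<lambda>u. s - u) ` N"])
      show "finite ((\<lambda>u. s - u) ` N)" using N by simp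
      show "continuous_on {0..s} (\<lambda>x. - exp (- x * l) * f (s - x))"
        by (intro continuous_intros continuous_on_compose2[OF cont]) auto
      fix x assume "x \<in> {0..s} - (\<lambda>u. s - u) ` N"
      then have "s - x \<notin> N" by force
      then have "((\<lambda>x. f (s - x)) has_real_derivative g (s - x) * (0 - 1)) (at x)"
        by (intro DERIV_chain2[OF deriv]) (auto intro!: derivative_eq_intros)
      then have "((\<lambda>x. - exp (- x * l) * f (s - x)) has_real_derivative h x) (at x)"
        using l by (auto intro!: derivative_eq_intros simp: h_def field_simps)
      then show "((\<lambda>x. - exp (- x * l) * f (s - x)) has_vector_derivative h x) (at x)"
        by (simp add: has_real_derivative_iff_has_vector_derivative)
    qed (use s in auto)
    then show ?thesis by simp
  qed
  have "compact (f ` {0..s})"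
    by (intro compact_continuous_image continuous_on_subset[OF cont]) auto
  then obtain B' where B': "\<And>x. x \<in> {0..s} \<Longrightarrow> \<bar>f x\<bar> \<le> B'"
    by (force dest!: compact_imp_bounded simp: bounded_iff)
  have bd: "\<bar>f (s - x) + g (s - x) / l\<bar> \<le> B' + B / l" if "0 \<le> x" "x \<le> s" for x
  proof -
    have "\<bar>g (s - x) / l\<bar> \<le> B / l" using g(2) l by (simp add: divide_right_mono)
    moreover have "\<bar>f (s - x)\<bar> \<le> B'" using that by (intro B') auto
    ultimately show ?thesis by linarith
  qed
  \<comment> \<open>The first branch of the integrand also covers negative x, which are null here;
    this permits cutting to {0..s}.\<close>
  have AE0: "AE x in density lborel (exponential_density l). 0 \<le> x"
    by (subst AE_density) (auto simp: exponential_density_def)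
  have hint: "set_integrable lborel {0..s} h"
    unfolding set_integrable_def
  proof (rule integrableI_bounded_set[where A = "{0..s}" and B = "l * (B' + B / l)"])
    show "AE x in lborel. x \<in> {0..s} \<longrightarrow> norm (indicator {0..s} x *\<^sub>R h x) \<le> l * (B' + B / l)"
    proof (intro AE_I2 impI)
      fix x assume x: "x \<in> {0..s}"
      have "\<bar>h x\<bar> = (l * exp (- x * l)) * \<bar>f (s - x) + g (s - x) / l\<bar>"
        using l by (simp add: h_def abs_mult)
      also have "\<dots> \<le> (l * 1) * (B' + B / l)"
        using l x bd[of x] by (intro mult_mono) auto
      finally show "norm (indicator {0..s} x *\<^sub>R h x) \<le> l * (B' + B / l)" using x by simp
    qed
  qed (auto simp: h_def emeasure_lborel_Icc_eq)
  have "(\<integral>x. (if x \<le> s then f (s - x) + g (s - x) / l else \<rho>) \<partial>density lborel (exponential_density l))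
     = (\<integral>x. indicator {0..s} x * (f (s - x) + g (s - x) / l) + \<rho> * indicator {s<..} x
          \<partial>density lborel (exponential_density l))"
    by (rule integral_cong_AE) (use AE0 in \<open>auto elim!: eventually_mono split: split_indicator\<close>)
  also have "\<dots> = (\<integral>x. indicator {0..s} x * (f (s - x) + g (s - x) / l) \<partial>density lborel (exponential_density l))
       + \<rho> * measure (density lborel (exponential_density l)) {s<..}"
  proof (subst Bochner_Integration.integral_add)
    show "integrable (density lborel (exponential_density l)) (\<lambda>x. indicator {0..s} x * (f (s - x) + g (s - x) / l))"
    proof (rule Ex.integrable_const_bound[where B = "\<bar>B' + B / l\<bar>"])
      show "AE x in density lborel (exponential_density l). norm (indicator {0..s} x * (f (s - x) + g (s - x) / l)) \<le> \<bar>B' + B / l\<bar>"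
        using AE0
      proof eventually_elim
        case (elim x)
        then show ?case using bd[of x] by (auto split: split_indicator)
      qed
    qed simp
    show "integrable (density lborel (exponential_density l)) (\<lambda>x. \<rho> * indicator {s<..} x)"
      by (rule Ex.integrable_const_bound[where B = "\<bar>\<rho>\<bar>"]) (auto split: split_indicator)
  qed simp
  also have "(\<integral>x. indicator {0..s} x * (f (s - x) + g (s - x) / l) \<partial>density lborel (exponential_density l))
     = (\<integral>x. exponential_density l x *\<^sub>R (indicator {0..s} x * (f (s - x) + g (s - x) / l)) \<partial>lborel)"
    using l by (intro integral_density) (auto intro: exponential_density_nonneg)
  also have "\<dots> = (LINT x:{0..s}|lborel. h x)"
    unfolding set_lebesgue_integral_def
    by (intro Bochner_Integration.integral_cong) (auto simp: exponential_density_def h_def split: split_indicator)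
  also have "\<dots> = f s - exp (- s * l) * f 0"
    using hi set_borel_integral_eq_integral(2)[OF hint] by (simp add: integral_unique)
  also have "measure (density lborel (exponential_density l)) {s<..} = exp (- l * s)"
    using Ex.exponential_distributedD_gt[of "\<lambda>x. x" l s] l s
    by (simp add: distributed_def distr_id2 greaterThan_def[symmetric] mult.commute)
  finally show ?thesis by (simp add: algebra_simps)
qed

section \<open>Non-anticipation and the time left\<close>

lemma decs_eq_act: "decs \<pi> \<omega> n i \<longleftrightarrow> i < n \<and> act \<pi> \<omega> i"
proof (induction n)
  case (Suc n)
  have "decs \<pi> \<omega> (Suc n) i = (if i = n then act \<pi> \<omega> n else decs \<pi> \<omega> n i)"
    by (auto simp: act_def Let_def)
  with Suc show ?case by auto
qed simp

text \<open>Stage \<open>Suc n\<close> of the recursion reads coordinates up to n only. This is what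
  will make the time left before a step independent of that step.\<close>

lemma decs_cong:
  assumes "\<And>i. i < n \<Longrightarrow> \<omega> i = \<omega>' i"
  shows "decs \<pi> \<omega> n = decs \<pi> \<omega>' n"
  using assms
proof (induction n)
  case (Suc n)
  then have eq: "decs \<pi> \<omega> n = decs \<pi> \<omega>' n" by auto
  have "So \<omega> i = So \<omega>' i" "Xo \<omega> i = Xo \<omega>' i" "Yo \<omega> i = Yo \<omega>' i" if "i \<le> n" for i
    using Suc.prems[of i] that by (auto simp: So_def Xo_def Yo_def)
  with eq show ?case
    by (auto simp: Let_def cong: if_cong intro!: arg_cong2[where f = "\<lambda>t h. \<pi> n (Xo \<omega>' n) t h"] fun_cong)
qed simp

text \<open>The state seen by the potentials: the time left before step n, negative once the horizon
  is passed. Policies may still use the whole history.\<close>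

definition remaining :: "policy \<Rightarrow> real \<Rightarrow> sample \<Rightarrow> nat \<Rightarrow> real" where
  "remaining \<pi> T \<omega> n = T - (\<Sum>i<n. So \<omega> i + Xo \<omega> i * of_bool (act \<pi> \<omega> i))"

lemma remaining_0 [simp]: "remaining \<pi> T \<omega> 0 = T"
  by (simp add: remaining_def)

lemma remaining_Suc:
  "remaining \<pi> T \<omega> (Suc n) = remaining \<pi> T \<omega> n - So \<omega> n - Xo \<omega> n * of_bool (act \<pi> \<omega> n)"
  by (simp add: remaining_def)

lemma remaining_cong:
  assumes "\<And>i. i < n \<Longrightarrow> \<omega> i = \<omega>' i"
  shows "remaining \<pi> T \<omega> n = remaining \<pi> T \<omega>' n"
proof -
  have "act \<pi> \<omega> i = act \<pi> \<omega>' i" if "i < n" for i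
    using decs_cong[of "Suc i" \<omega> \<omega>' \<pi>] assms that by (auto simp: act_def)
  then show ?thesis
    using assms by (auto simp: remaining_def So_def Xo_def intro!: sum.cong)
qed

section \<open>The probability space and the law of one step\<close>

locale task_model =
  fixes l C M :: real and \<nu> :: "(real \<times> real) measure" and r :: "real \<Rightarrow> real"
  assumes l_pos: "0 < l" and C_pos: "0 < C"
    and nu_prob: "prob_space \<nu>"
    and nu_sets [measurable_cong]: "sets \<nu> = sets (borel \<Otimes>\<^sub>M borel)"
    and X_range: "AE p in \<nu>. fst p \<in> {0..C}"
    and r_meas [measurable]: "r \<in> borel_measurable borel"
    and r_bound: "\<And>x. x \<in> {0..C} \<Longrightarrow> \<bar>r x\<bar> \<le> M"
begin

abbreviation "idle \<equiv> density lborel (exponential_density l)"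
abbreviation "\<mu> \<equiv> step_measure l \<nu>"
abbreviation "\<Omega> \<equiv> Omega l \<nu>"

sublocale nu: prob_space \<nu> by (rule nu_prob)
sublocale idle: prob_space idle using l_pos by (rule prob_space_exponential_density)
sublocale idle_nu: pair_prob_space idle \<nu> ..

lemma mu_prob: "prob_space \<mu>"
  unfolding step_measure_def by (rule idle_nu.prob_space_axioms)

sublocale mu: prob_space \<mu> by (rule mu_prob)
sublocale steps: product_prob_space "\<lambda>_::nat. \<mu>" UNIV ..
sublocale Om: prob_space \<Omega>
  unfolding Omega_def by (rule steps.prob_space_axioms)

lemma sets_mu [measurable_cong]: "sets \<mu> = sets (borel \<Otimes>\<^sub>M (borel \<Otimes>\<^sub>M borel))"
  unfolding step_measure_def by (intro sets_pair_measure_cong) (simp_all add: nu_sets)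

lemma measurable_step [measurable]: "(\<lambda>\<omega>. \<omega> n) \<in> \<Omega> \<rightarrow>\<^sub>M \<mu>"
  unfolding Omega_def by simp

lemma measurable_mu_components [measurable]:
  "fst \<in> borel_measurable \<mu>" "(\<lambda>y. fst (snd y)) \<in> borel_measurable \<mu>" "(\<lambda>y. snd (snd y)) \<in> borel_measurable \<mu>"
  by (simp_all add: measurable_cong_sets[OF sets_mu refl])

lemma measurable_So [measurable]: "(\<lambda>\<omega>. So \<omega> n) \<in> borel_measurable \<Omega>"
  and measurable_Xo [measurable]: "(\<lambda>\<omega>. Xo \<omega> n) \<in> borel_measurable \<Omega>"
  and measurable_Yo [measurable]: "(\<lambda>\<omega>. Yo \<omega> n) \<in> borel_measurable \<Omega>"
  unfolding So_def Xo_def Yo_def by (auto intro: measurable_compose[OF measurable_step])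

text \<open>Strong induction, since the time and the history shown to the policy at step n involve
  all earlier decisions.\<close>

lemma measurable_act:
  assumes "admissible \<pi>"
  shows "Measurable.pred \<Omega> (\<lambda>\<omega>. act \<pi> \<omega> n)"
proof (induction n rule: less_induct)
  case (less n)
  have [measurable]: "Measurable.pred \<Omega> (\<lambda>\<omega>. decs \<pi> \<omega> n i)" for i
    unfolding decs_eq_act using less by (cases "i < n") auto
  have [measurable]: "(\<lambda>(x, t, h). \<pi> n x t h) \<in>
      measurable (borel \<Otimes>\<^sub>M borel \<Otimes>\<^sub>M (\<Pi>\<^sub>M i\<in>(UNIV::nat set). (borel \<Otimes>\<^sub>M borel))) (count_space UNIV)"
    using assms by (simp add: admissible_def)
  define t where "t \<omega> = (\<Sum>i<n. So \<omega> i + Xo \<omega> i * of_bool (decs \<pi> \<omega> n i)) + So \<omega> n" for \<omega>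
  define h where "h \<omega> = (\<lambda>i. if i < n then (Xo \<omega> i, if decs \<pi> \<omega> n i then Yo \<omega> i else 0) else (0, 0))" for \<omega>
  have [measurable]: "t \<in> borel_measurable \<Omega>"
    unfolding t_def by measurable
  have [measurable]: "h \<in> \<Omega> \<rightarrow>\<^sub>M (\<Pi>\<^sub>M i\<in>(UNIV::nat set). (borel \<Otimes>\<^sub>M borel))"
    unfolding h_def by (rule measurable_PiM_single') (auto simp: space_pair_measure)
  have "(\<lambda>\<omega>. (\<lambda>(x, t, h). \<pi> n x t h) (Xo \<omega> n, t \<omega>, h \<omega>)) \<in> \<Omega> \<rightarrow>\<^sub>M count_space UNIV"
    by measurable
  moreover have "act \<pi> \<omega> n = (\<lambda>(x, t, h). \<pi> n x t h) (Xo \<omega> n, t \<omega>, h \<omega>)" for \<omega>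
    by (simp add: act_def Let_def t_def h_def)
  ultimately show ?case by simp
qed

lemma measurable_remaining:
  assumes "admissible \<pi>"
  shows "(\<lambda>\<omega>. remaining \<pi> T \<omega> n) \<in> borel_measurable \<Omega>"
proof -
  note measurable_act[OF assms, measurable]
  show ?thesis unfolding remaining_def by measurable
qed

text \<open>The time left before step n is a function of the coordinates below n, and these are
  independent of coordinate n. Stated as an equality of measures, the independence feeds directly
  into Fubini.\<close>

lemma distr_remaining_step:
  assumes "admissible \<pi>"
  shows "distr \<Omega> borel (\<lambda>\<omega>. remaining \<pi> T \<omega> n) \<Otimes>\<^sub>M \<mu> =
    distr \<Omega> (borel \<Otimes>\<^sub>M \<mu>) (\<lambda>\<omega>. (remaining \<pi> T \<omega> n, \<omega> n))"
proof -
  let ?past = "\<lambda>\<omega>. restrict (\<lambda>i. \<omega> i) {..<n}" and ?now = "\<lambda>\<omega>. restrict (\<lambda>i. \<omega> i) {n}"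
  let ?P = "PiM {..<n} (\<lambda>_. \<mu>)" and ?N = "PiM {n} (\<lambda>_. \<mu>)"
  have "Om.indep_vars (\<lambda>_. \<mu>) (\<lambda>i \<omega>. \<omega> i) UNIV"
  proof (subst Om.indep_vars_iff_distr_eq_PiM')
    have "distr \<Omega> (Pi\<^sub>M UNIV (\<lambda>_. \<mu>)) (\<lambda>x. \<lambda>i\<in>UNIV. x i) = \<Omega>"
      unfolding Omega_def by (simp add: distr_id2 restrict_UNIV)
    then show "distr \<Omega> (Pi\<^sub>M UNIV (\<lambda>_. \<mu>)) (\<lambda>x. \<lambda>i\<in>UNIV. x i) = (\<Pi>\<^sub>M i\<in>UNIV. distr \<Omega> \<mu> (\<lambda>\<omega>. \<omega> i))"
      unfolding Omega_def by (simp add: steps.PiM_component)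
  qed auto
  then have "Om.indep_var ?P ?past ?N ?now"
    by (rule Om.indep_var_restrict) auto
  then have past [measurable]: "?past \<in> \<Omega> \<rightarrow>\<^sub>M ?P" and now [measurable]: "?now \<in> \<Omega> \<rightarrow>\<^sub>M ?N"
    and indep: "distr \<Omega> ?P ?past \<Otimes>\<^sub>M distr \<Omega> ?N ?now = distr \<Omega> (?P \<Otimes>\<^sub>M ?N) (\<lambda>\<omega>. (?past \<omega>, ?now \<omega>))"
    by (auto simp: Om.indep_var_distribution_eq)
  \<comment> \<open>\<open>remaining\<close> expects a whole sample, so the restricted past is
    continued by dummy triples; by \<open>remaining_cong\<close> they do not influence the
    value.\<close>
  define e where "e \<omega> = (\<lambda>i. if i < n then \<omega> i else (0, 0, 0))" for \<omega> :: sample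
  have [measurable]: "e \<in> ?P \<rightarrow>\<^sub>M \<Omega>"
    unfolding e_def Omega_def
  proof (rule measurable_PiM_single')
    fix i show "(\<lambda>\<omega>. if i < n then \<omega> i else (0, 0, 0)) \<in> ?P \<rightarrow>\<^sub>M \<mu>"
      by (cases "i < n") (auto simp: sets_eq_imp_space_eq[OF sets_mu] space_pair_measure)
  qed (auto simp: sets_eq_imp_space_eq[OF sets_mu] space_pair_measure)
  note measurable_remaining[OF assms, measurable]
  have eq: "remaining \<pi> T (e (?past \<omega>)) n = remaining \<pi> T \<omega> n" for \<omega>
    by (rule remaining_cong) (simp add: e_def)
  have R: "distr \<Omega> borel (\<lambda>\<omega>. remaining \<pi> T \<omega> n)
      = distr (distr \<Omega> ?P ?past) borel (\<lambda>\<omega>. remaining \<pi> T (e \<omega>) n)"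
    by (subst distr_distr) (auto simp: comp_def eq)
  have S: "\<mu> = distr (distr \<Omega> ?N ?now) \<mu> (\<lambda>\<omega>. \<omega> n)"
  proof (subst distr_distr)
    have "distr \<Omega> \<mu> (\<lambda>\<omega>. \<omega> n) = \<mu>"
      unfolding Omega_def by (rule steps.PiM_component) simp
    then show "\<mu> = distr \<Omega> \<mu> ((\<lambda>\<omega>. \<omega> n) \<circ> ?now)"
      by (simp add: comp_def)
  qed auto
  have "distr \<Omega> borel (\<lambda>\<omega>. remaining \<pi> T \<omega> n) \<Otimes>\<^sub>M \<mu>
    = distr (distr \<Omega> ?P ?past) borel (\<lambda>\<omega>. remaining \<pi> T (e \<omega>) n) \<Otimes>\<^sub>M distr (distr \<Omega> ?N ?now) \<mu> (\<lambda>\<omega>. \<omega> n)"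
    using R S by simp
  also have "\<dots> = distr (distr \<Omega> ?P ?past \<Otimes>\<^sub>M distr \<Omega> ?N ?now) (borel \<Otimes>\<^sub>M \<mu>)
      (\<lambda>(\<omega>, \<omega>'). (remaining \<pi> T (e \<omega>) n, \<omega>' n))"
    by (rule pair_measure_distr) (use S in \<open>auto simp: mu.sigma_finite_measure_axioms\<close>)
  also have "\<dots> = distr \<Omega> (borel \<Otimes>\<^sub>M \<mu>) (\<lambda>\<omega>. (remaining \<pi> T \<omega> n, \<omega> n))"
    unfolding indep by (subst distr_distr) (auto simp: comp_def eq)
  finally show ?thesis .
qed

text \<open>Substitute for conditioning on the past: the time left is frozen and only the fresh step
  is averaged.\<close>

lemma integral_remaining_step:
  fixes G :: "real \<times> real \<times> real \<times> real \<Rightarrow> real"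
  assumes \<pi>: "admissible \<pi>" and G [measurable]: "G \<in> borel_measurable (borel \<Otimes>\<^sub>M \<mu>)"
    and int: "integrable \<Omega> (\<lambda>\<omega>. G (remaining \<pi> T \<omega> n, \<omega> n))"
  shows "(\<integral>\<omega>. G (remaining \<pi> T \<omega> n, \<omega> n) \<partial>\<Omega>) = (\<integral>\<omega>. (\<integral>y. G (remaining \<pi> T \<omega> n, y) \<partial>\<mu>) \<partial>\<Omega>)"
proof -
  note measurable_remaining[OF \<pi>, measurable]
  let ?R = "distr \<Omega> borel (\<lambda>\<omega>. remaining \<pi> T \<omega> n)"
  interpret R: prob_space ?R by (rule Om.prob_space_distr) simp
  interpret Rm: pair_prob_space ?R \<mu> ..
  have "(\<integral>\<omega>. G (remaining \<pi> T \<omega> n, \<omega> n) \<partial>\<Omega>) = integral\<^sup>L (?R \<Otimes>\<^sub>M \<mu>) G"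
    by (simp add: distr_remaining_step[OF \<pi>] integral_distr)
  also have "\<dots> = (\<integral>s. (\<integral>y. G (s, y) \<partial>\<mu>) \<partial>?R)"
    by (rule Rm.integral_fst'[symmetric])
      (use int in \<open>simp add: distr_remaining_step[OF \<pi>] integrable_distr_eq\<close>)
  also have "\<dots> = (\<integral>\<omega>. (\<integral>y. G (remaining \<pi> T \<omega> n, y) \<partial>\<mu>) \<partial>\<Omega>)"
    by (rule integral_distr) auto
  finally show ?thesis .
qed

section \<open>Almost sure regularity and geometric extinction\<close>

abbreviation regular :: "real \<times> real \<times> real \<Rightarrow> bool" where
  "regular y \<equiv> 0 < fst y \<and> 0 \<le> fst (snd y) \<and> fst (snd y) \<le> C"

lemma AE_mu_regular: "AE y in \<mu>. regular y"
  unfolding step_measure_def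
proof (rule idle_nu.AE_pair_measure)
  show "{y \<in> space (idle \<Otimes>\<^sub>M \<nu>). regular y} \<in> sets (idle \<Otimes>\<^sub>M \<nu>)"
    unfolding step_measure_def[symmetric] by measurable
  have "AE x in lborel. x \<noteq> (0::real)" by (rule AE_lborel_singleton)
  then have "AE x in idle. 0 < x"
    by (subst AE_density) (auto simp: exponential_density_def elim!: eventually_mono)
  then show "AE x in idle. AE p in \<nu>. regular (x, p)"
    using X_range by (auto elim!: eventually_mono)
qed

lemma AE_Omega_regular: "AE \<omega> in \<Omega>. \<forall>n. regular (\<omega> n)"
  unfolding AE_all_countable Omega_def
  by (intro allI AE_PiM_component AE_mu_regular mu_prob) auto

lemma remaining_antimono:
  assumes "\<forall>n. regular (\<omega> n)" "m \<le> n"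
  shows "remaining \<pi> T \<omega> n \<le> remaining \<pi> T \<omega> m"
  using assms(2)
proof (induction rule: dec_induct)
  case (step k)
  then show ?case using assms(1)[rule_format, of k]
    by (auto simp: remaining_Suc So_def Xo_def of_bool_def)
qed simp

lemma remaining_le:
  assumes "\<forall>n. regular (\<omega> n)"
  shows "remaining \<pi> T \<omega> n \<le> T"
  using remaining_antimono[OF assms, of 0 n] by simp

text \<open>Exponential Markov inequality: the probability is at most the mean of \<open>exp\<close>
  of the time left. Each step multiplies this mean by at most \<open>q\<close>, the mean of exp(-S).
  Tasks may be rejected or have duration 0, so only the idle times enforce the decay.\<close>

lemma prob_alive_bound:
  assumes \<pi>: "admissible \<pi>"
  obtains q where "0 \<le> q" "q < 1"
    "\<And>n. Om.prob {\<omega> \<in> space \<Omega>. 0 \<le> remaining \<pi> T \<omega> n} \<le> exp T * q ^ n"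
proof
  define q where "q = (\<integral>y. exp (- fst y) \<partial>\<mu>)"
  note measurable_remaining[OF \<pi>, measurable]
  have int_q: "integrable \<mu> (\<lambda>y. exp (- fst y))"
    by (rule mu.integrable_const_bound[where B = 1]) (use AE_mu_regular in \<open>auto elim!: eventually_mono\<close>)
  show q0: "0 \<le> q" unfolding q_def by (rule integral_nonneg_AE) simp
  \<comment> \<open>Strictness comes from idle times being almost surely positive.\<close>
  have "q < (\<integral>y. 1 \<partial>\<mu>)"
    unfolding q_def
    by (rule mu.integral_less_AE_space)
      (use int_q AE_mu_regular in \<open>auto elim!: eventually_mono simp: mu.emeasure_space_1\<close>)
  then show "q < 1" by (simp add: mu.prob_space)
  have int: "integrable \<Omega> (\<lambda>\<omega>. exp (remaining \<pi> T \<omega> n))" for n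
    by (rule Om.integrable_const_bound[where B = "exp T"])
      (use AE_Omega_regular in \<open>auto elim!: eventually_mono simp: remaining_le\<close>)
  have decay: "(\<integral>\<omega>. exp (remaining \<pi> T \<omega> n) \<partial>\<Omega>) \<le> exp T * q ^ n" for n
  proof (induction n)
    case 0
    show ?case by (simp add: Om.prob_space)
  next
    case (Suc n)
    let ?G = "\<lambda>(s, y::real \<times> real \<times> real). exp s * exp (- fst y) :: real"
    have intG: "integrable \<Omega> (\<lambda>\<omega>. ?G (remaining \<pi> T \<omega> n, \<omega> n))"
    proof (rule Om.integrable_const_bound[where B = "exp T"])
      show "AE \<omega> in \<Omega>. norm (?G (remaining \<pi> T \<omega> n, \<omega> n)) \<le> exp T"
        using AE_Omega_regular
      proof eventually_elim
        case (elim \<omega>)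
        have "0 < fst (\<omega> n)" using elim by auto
        then show ?case
          using remaining_le[OF elim, of \<pi> T n] by (simp add: exp_add[symmetric])
      qed
    qed measurable
    have "(\<integral>\<omega>. exp (remaining \<pi> T \<omega> (Suc n)) \<partial>\<Omega>) \<le> (\<integral>\<omega>. ?G (remaining \<pi> T \<omega> n, \<omega> n) \<partial>\<Omega>)"
    proof (rule integral_mono_AE[OF int intG])
      show "AE \<omega> in \<Omega>. exp (remaining \<pi> T \<omega> (Suc n)) \<le> ?G (remaining \<pi> T \<omega> n, \<omega> n)"
        using AE_Omega_regular
      proof eventually_elim
        case (elim \<omega>)
        have "0 \<le> Xo \<omega> n" using elim by (auto simp: Xo_def)
        then show ?case
          by (simp add: remaining_Suc So_def exp_add[symmetric] of_bool_def)
      qed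
    qed
    also have "\<dots> = q * (\<integral>\<omega>. exp (remaining \<pi> T \<omega> n) \<partial>\<Omega>)"
      using int_q by (subst integral_remaining_step[OF \<pi> _ intG]) (auto simp: q_def)
    also have "\<dots> \<le> q * (exp T * q ^ n)"
      using Suc q0 by (rule mult_left_mono)
    finally show ?case by (simp add: ac_simps)
  qed
  fix n
  have "Om.prob {\<omega> \<in> space \<Omega>. 0 \<le> remaining \<pi> T \<omega> n}
      = (\<integral>\<omega>. indicator {\<omega> \<in> space \<Omega>. 0 \<le> remaining \<pi> T \<omega> n} \<omega> \<partial>\<Omega>)"
    by simp
  also have "\<dots> \<le> (\<integral>\<omega>. exp (remaining \<pi> T \<omega> n) \<partial>\<Omega>)"
    by (rule integral_mono[OF _ int])
      (auto split: split_indicator simp: less_top[symmetric] intro!: integrable_real_indicator)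
  also have "\<dots> \<le> exp T * q ^ n" by (rule decay)
  finally show "Om.prob {\<omega> \<in> space \<Omega>. 0 \<le> remaining \<pi> T \<omega> n} \<le> exp T * q ^ n" .
qed

section \<open>Expected reward as a series, and telescoping of the drift\<close>

text \<open>Testing the time left before the step replaces the random range up to
  \<open>theta\<close> by a series over all n. The step that crosses the horizon starts with
  nonnegative time left, so it is counted even if its task is proposed after
  \<open>T\<close>.\<close>

definition step_reward :: "policy \<Rightarrow> real \<Rightarrow> nat \<Rightarrow> sample \<Rightarrow> real" where
  "step_reward \<pi> T n \<omega> = r (Xo \<omega> n) * of_bool (act \<pi> \<omega> n \<and> 0 \<le> remaining \<pi> T \<omega> n)"

lemma measurable_step_reward:
  assumes "admissible \<pi>"
  shows "step_reward \<pi> T n \<in> borel_measurable \<Omega>"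
proof -
  note measurable_remaining[OF assms, measurable] measurable_act[OF assms, measurable]
  show ?thesis unfolding step_reward_def by measurable
qed

lemma measurable_total_reward:
  assumes "admissible \<pi>"
  shows "total_reward \<pi> r T \<in> borel_measurable \<Omega>"
proof -
  note measurable_act[OF assms, measurable]
  have "theta \<pi> T \<in> \<Omega> \<rightarrow>\<^sub>M count_space UNIV"
    unfolding theta_def busy_def by measurable
  then have "(\<lambda>\<omega>. (\<lambda>n \<omega>. \<Sum>k\<le>n. r (Xo \<omega> k) * of_bool (act \<pi> \<omega> k)) (theta \<pi> T \<omega>) \<omega>) \<in> borel_measurable \<Omega>"
    by (rule measurable_compose_countable[rotated]) measurable
  then show ?thesis by (simp add: total_reward_def[abs_def])
qed

lemma step_reward_abs_le:
  assumes "\<forall>n. regular (\<omega> n)"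
  shows "\<bar>step_reward \<pi> T n \<omega>\<bar> \<le> M * of_bool (0 \<le> remaining \<pi> T \<omega> n)"
  using assms r_bound[of "Xo \<omega> n"] by (auto simp: step_reward_def Xo_def)

lemma step_reward_sums_total:
  assumes reg: "\<forall>n. regular (\<omega> n)" and T: "0 \<le> T" and n: "remaining \<pi> T \<omega> n < 0"
  shows "(\<lambda>k. step_reward \<pi> T k \<omega>) sums total_reward \<pi> r T \<omega>"
proof -
  \<comment> \<open>\<open>busy\<close> at k includes step k whereas \<open>remaining\<close> at k
    stops before it, hence the shift.\<close>
  have busy: "busy \<pi> \<omega> k > T \<longleftrightarrow> remaining \<pi> T \<omega> (Suc k) < 0" for k
    by (simp add: busy_def remaining_def lessThan_Suc_atMost)
  \<comment> \<open>Index 0 is excluded by T \<ge> 0, so some \<open>busy\<close> value exceeds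
    \<open>T\<close> and the \<open>LEAST\<close> in \<open>theta\<close> is attained.\<close>
  obtain m where "n = Suc m" using n T by (cases n) auto
  with n have "busy \<pi> \<omega> m > T" by (simp add: busy)
  then have "busy \<pi> \<omega> (theta \<pi> T \<omega>) > T"
    unfolding theta_def by (rule LeastI)
  then have dead: "remaining \<pi> T \<omega> (Suc (theta \<pi> T \<omega>)) < 0" by (simp add: busy)
  have alive: "0 \<le> remaining \<pi> T \<omega> k \<longleftrightarrow> k \<le> theta \<pi> T \<omega>" for k
  proof
    assume "0 \<le> remaining \<pi> T \<omega> k"
    then show "k \<le> theta \<pi> T \<omega>"
      using dead remaining_antimono[OF reg, of "Suc (theta \<pi> T \<omega>)" k \<pi> T] by force
  next
    assume k: "k \<le> theta \<pi> T \<omega>"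
    show "0 \<le> remaining \<pi> T \<omega> k"
    proof (cases k)
      case (Suc j)
      then have "\<not> busy \<pi> \<omega> j > T" using k unfolding theta_def by (intro not_less_Least) auto
      then show ?thesis using Suc by (simp add: busy)
    qed (use T in simp)
  qed
  have "(\<lambda>k. step_reward \<pi> T k \<omega>) sums (\<Sum>k\<le>theta \<pi> T \<omega>. step_reward \<pi> T k \<omega>)"
    by (rule sums_finite) (auto simp: step_reward_def alive)
  then show ?thesis by (simp add: total_reward_def step_reward_def alive)
qed

definition drift :: "policy \<Rightarrow> real \<Rightarrow> (real \<Rightarrow> real) \<Rightarrow> nat \<Rightarrow> sample \<Rightarrow> real" where
  "drift \<pi> T f n \<omega> = step_reward \<pi> T n \<omega> + (f (remaining \<pi> T \<omega> (Suc n)) - f (remaining \<pi> T \<omega> n))"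

text \<open>The step rewards sum to the expected reward, and the potential terms telescope from
  \<open>f T\<close> to the limit of the mean potentials. That limit is 0: \<open>f\<close> vanishes
  at negative arguments and is bounded up to \<open>T\<close>, which the time left never exceeds, so
  the means are controlled by the survival probabilities.\<close>

lemma
  assumes \<pi>: "admissible \<pi>" and T: "0 \<le> T" and f [measurable]: "f \<in> borel_measurable borel"
    and f_neg: "\<And>s. s < 0 \<Longrightarrow> f s = 0" and f_bound: "\<And>s. s \<le> T \<Longrightarrow> \<bar>f s\<bar> \<le> B"
  shows integrable_drift: "integrable \<Omega> (drift \<pi> T f n)"
    and drift_sums: "(\<lambda>n. \<integral>\<omega>. drift \<pi> T f n \<omega> \<partial>\<Omega>) sums (U l \<nu> r T \<pi> - f T)"
proof -
  note measurable_remaining[OF \<pi>, measurable] measurable_step_reward[OF \<pi>, measurable]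
  let ?alive = "\<lambda>n. {\<omega> \<in> space \<Omega>. 0 \<le> remaining \<pi> T \<omega> n}"
  obtain q where q: "0 \<le> q" "q < 1" "\<And>n. Om.prob (?alive n) \<le> exp T * q ^ n"
    using prob_alive_bound[OF \<pi>, of T] by blast
  have summable: "summable (\<lambda>n. Om.prob (?alive n))"
    by (rule summable_comparison_test'[OF summable_mult[OF summable_geometric[of q], of "exp T"]])
      (use q in auto)
  \<comment> \<open>Step reward and potential both vanish off the survival event, so one domination
    by a multiple of its indicator handles both.\<close>
  have dominated: "integrable \<Omega> Z \<and> (\<integral>\<omega>. \<bar>Z \<omega>\<bar> \<partial>\<Omega>) \<le> K * Om.prob (?alive n)"
    if Z [measurable]: "Z \<in> borel_measurable \<Omega>"
      and le: "AE \<omega> in \<Omega>. \<bar>Z \<omega>\<bar> \<le> K * of_bool (0 \<le> remaining \<pi> T \<omega> n)" for Z K n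
  proof
    have K: "integrable \<Omega> (\<lambda>\<omega>. K * indicator (?alive n) \<omega>)"
      by (intro integrable_mult_right integrable_real_indicator) (auto simp: less_top[symmetric])
    have le': "AE \<omega> in \<Omega>. \<bar>Z \<omega>\<bar> \<le> K * indicator (?alive n) \<omega>"
      using le AE_space by eventually_elim (auto simp: of_bool_def split: if_splits)
    show int: "integrable \<Omega> Z"
      by (rule Bochner_Integration.integrable_bound[OF K]) (use le' in \<open>auto elim!: eventually_mono\<close>)
    have "(\<integral>\<omega>. \<bar>Z \<omega>\<bar> \<partial>\<Omega>) \<le> (\<integral>\<omega>. K * indicator (?alive n) \<omega> \<partial>\<Omega>)"
      using int K le' by (intro integral_mono_AE) auto
    then show "(\<integral>\<omega>. \<bar>Z \<omega>\<bar> \<partial>\<Omega>) \<le> K * Om.prob (?alive n)" by simp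
  qed
  have reward: "integrable \<Omega> (step_reward \<pi> T n)"
      "(\<integral>\<omega>. \<bar>step_reward \<pi> T n \<omega>\<bar> \<partial>\<Omega>) \<le> M * Om.prob (?alive n)" for n
  proof -
    have "AE \<omega> in \<Omega>. \<bar>step_reward \<pi> T n \<omega>\<bar> \<le> M * of_bool (0 \<le> remaining \<pi> T \<omega> n)"
      using AE_Omega_regular by eventually_elim (rule step_reward_abs_le)
    then show "integrable \<Omega> (step_reward \<pi> T n)"
      "(\<integral>\<omega>. \<bar>step_reward \<pi> T n \<omega>\<bar> \<partial>\<Omega>) \<le> M * Om.prob (?alive n)"
      using dominated[of "step_reward \<pi> T n" M n] by auto
  qed
  have potential: "integrable \<Omega> (\<lambda>\<omega>. f (remaining \<pi> T \<omega> n))"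
      "(\<integral>\<omega>. \<bar>f (remaining \<pi> T \<omega> n)\<bar> \<partial>\<Omega>) \<le> B * Om.prob (?alive n)" for n
  proof -
    have "AE \<omega> in \<Omega>. \<bar>f (remaining \<pi> T \<omega> n)\<bar> \<le> B * of_bool (0 \<le> remaining \<pi> T \<omega> n)"
      using AE_Omega_regular by eventually_elim (auto simp: f_neg f_bound remaining_le)
    then show "integrable \<Omega> (\<lambda>\<omega>. f (remaining \<pi> T \<omega> n))"
      "(\<integral>\<omega>. \<bar>f (remaining \<pi> T \<omega> n)\<bar> \<partial>\<Omega>) \<le> B * Om.prob (?alive n)"
      using dominated[of "\<lambda>\<omega>. f (remaining \<pi> T \<omega> n)" B n] by auto
  qed
  show "integrable \<Omega> (drift \<pi> T f n)"
    unfolding drift_def[abs_def] using reward potential by auto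
  \<comment> \<open>Borel-Cantelli: almost every run exhausts its time, as
    \<open>step_reward_sums_total\<close> requires.\<close>
  have "AE \<omega> in \<Omega>. eventually (\<lambda>n. \<omega> \<in> space \<Omega> - ?alive n) sequentially"
    by (rule borel_cantelli_AE1) (auto simp: summable less_top[symmetric])
  then have sums: "AE \<omega> in \<Omega>. (\<lambda>n. step_reward \<pi> T n \<omega>) sums total_reward \<pi> r T \<omega> \<and>
      summable (\<lambda>n. norm (step_reward \<pi> T n \<omega>))"
    using AE_Omega_regular
  proof eventually_elim
    case (elim \<omega>)
    then obtain N where N: "\<And>n. n \<ge> N \<Longrightarrow> remaining \<pi> T \<omega> n < 0"
      by (auto simp: eventually_sequentially not_le)
    have "summable (\<lambda>n. norm (step_reward \<pi> T n \<omega>))"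
    proof (rule summable_finite[of "{..<N}"])
      fix n assume "n \<notin> {..<N}"
      then show "norm (step_reward \<pi> T n \<omega>) = 0" using N[of n] by (simp add: step_reward_def)
    qed simp
    with step_reward_sums_total[OF _ T N[of N]] elim show ?case by auto
  qed
  have "(\<lambda>n. \<integral>\<omega>. step_reward \<pi> T n \<omega> \<partial>\<Omega>) sums (\<integral>\<omega>. (\<Sum>n. step_reward \<pi> T n \<omega>) \<partial>\<Omega>)"
  proof (rule sums_integral[OF reward(1)])
    show "AE \<omega> in \<Omega>. summable (\<lambda>n. norm (step_reward \<pi> T n \<omega>))"
      using sums by eventually_elim auto
    show "summable (\<lambda>n. \<integral>\<omega>. norm (step_reward \<pi> T n \<omega>) \<partial>\<Omega>)"
      by (rule summable_comparison_test'[OF summable_mult[OF summable, of M]]) (use reward(2) in auto)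
  qed
  also have "(\<integral>\<omega>. (\<Sum>n. step_reward \<pi> T n \<omega>) \<partial>\<Omega>) = U l \<nu> r T \<pi>"
    unfolding U_def
    by (rule integral_cong_AE)
      (use sums measurable_total_reward[OF \<pi>] in \<open>auto elim!: eventually_mono simp: sums_iff\<close>)
  finally have U: "(\<lambda>n. \<integral>\<omega>. step_reward \<pi> T n \<omega> \<partial>\<Omega>) sums U l \<nu> r T \<pi>" .
  have "(\<lambda>n. \<integral>\<omega>. f (remaining \<pi> T \<omega> n) \<partial>\<Omega>) \<longlonglongrightarrow> 0"
  proof (rule Lim_null_comparison)
    show "(\<lambda>n. B * Om.prob (?alive n)) \<longlonglongrightarrow> 0"
      using summable_LIMSEQ_zero[OF summable] by (rule tendsto_mult_right_zero)
    show "\<forall>\<^sub>F n in sequentially. norm (\<integral>\<omega>. f (remaining \<pi> T \<omega> n) \<partial>\<Omega>) \<le> B * Om.prob (?alive n)"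
    proof (intro always_eventually allI)
      fix n
      show "norm (\<integral>\<omega>. f (remaining \<pi> T \<omega> n) \<partial>\<Omega>) \<le> B * Om.prob (?alive n)"
        using potential(2)[of n] unfolding real_norm_def by (rule order_trans[OF integral_abs_bound])
    qed
  qed
  from sums_add[OF U telescope_sums[OF this]]
  show "(\<lambda>n. \<integral>\<omega>. drift \<pi> T f n \<omega> \<partial>\<Omega>) sums (U l \<nu> r T \<pi> - f T)"
    unfolding drift_def using reward(1) potential(1) by (simp add: Om.prob_space)
qed

section \<open>Verification with super- and subsolutions\<close>

text \<open>Bounds on \<open>K\<close> are available only for times in [0, T]. The cutoff is
  harmless for drifts: they vanish almost surely at negative time left, and the time left is almost
  surely at most \<open>T\<close>.\<close>

lemma
  assumes \<pi>: "admissible \<pi>" and K [measurable]: "K \<in> borel_measurable (borel \<Otimes>\<^sub>M \<mu>)"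
    and bound: "\<And>s y. 0 \<le> s \<Longrightarrow> s \<le> T \<Longrightarrow> regular y \<Longrightarrow> \<bar>K (s, y)\<bar> \<le> B" and B: "0 \<le> B"
  defines "G \<equiv> \<lambda>(s, y). if 0 \<le> s \<and> s \<le> T then K (s, y) else (0::real)"
  shows integrable_alive_step: "integrable \<Omega> (\<lambda>\<omega>. G (remaining \<pi> T \<omega> n, \<omega> n))"
    and integral_alive_step: "(\<integral>\<omega>. G (remaining \<pi> T \<omega> n, \<omega> n) \<partial>\<Omega>) =
      (\<integral>\<omega>. (if 0 \<le> remaining \<pi> T \<omega> n \<and> remaining \<pi> T \<omega> n \<le> T
            then \<integral>y. K (remaining \<pi> T \<omega> n, y) \<partial>\<mu> else 0) \<partial>\<Omega>)"
proof -
  note measurable_remaining[OF \<pi>, measurable]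
  have G [measurable]: "G \<in> borel_measurable (borel \<Otimes>\<^sub>M \<mu>)"
    unfolding G_def by measurable
  show int: "integrable \<Omega> (\<lambda>\<omega>. G (remaining \<pi> T \<omega> n, \<omega> n))"
    by (rule Om.integrable_const_bound[where B = B])
      (use AE_Omega_regular in \<open>auto elim!: eventually_mono simp: G_def bound B\<close>)
  show "(\<integral>\<omega>. G (remaining \<pi> T \<omega> n, \<omega> n) \<partial>\<Omega>) =
      (\<integral>\<omega>. (if 0 \<le> remaining \<pi> T \<omega> n \<and> remaining \<pi> T \<omega> n \<le> T
            then \<integral>y. K (remaining \<pi> T \<omega> n, y) \<partial>\<mu> else 0) \<partial>\<Omega>)"
    unfolding integral_remaining_step[OF \<pi> G int]
    by (rule Bochner_Integration.integral_cong) (auto simp: G_def)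
qed

lemma M_nonneg: "0 \<le> M"
  using r_bound[of 0] C_pos by auto

text \<open>The decision may depend on the whole history, so the drift is not a function of the time
  left and the current step. Replacing it by the better of the two decisions (\<open>H\<close>)
  gives such a bound, uniformly in the policy. \<open>Q\<close> is a majorant of \<open>H\<close>
  whose mean is explicit.\<close>

lemma U_le_supersolution:
  assumes \<pi>: "admissible \<pi>" and T: "0 \<le> T" and f [measurable]: "f \<in> borel_measurable borel"
    and f_neg: "\<And>s. s < 0 \<Longrightarrow> f s = 0" and f_bound: "\<And>s. s \<le> T \<Longrightarrow> \<bar>f s\<bar> \<le> B"
    and Q_int: "\<And>s. 0 \<le> s \<Longrightarrow> s \<le> T \<Longrightarrow> integrable \<mu> (Q s)"
    and Q_ge: "\<And>s y. 0 \<le> s \<Longrightarrow> s \<le> T \<Longrightarrow> regular y \<Longrightarrow>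
      max (f (s - fst y)) (r (fst (snd y)) + f (s - fst y - fst (snd y))) \<le> Q s y"
    and Q_le: "\<And>s. 0 \<le> s \<Longrightarrow> s \<le> T \<Longrightarrow> (\<integral>y. Q s y \<partial>\<mu>) \<le> f s"
  shows "U l \<nu> r T \<pi> \<le> f T"
proof -
  define H where "H s y = max (f (s - fst y)) (r (fst (snd y)) + f (s - fst y - fst (snd y)))"
    for s and y :: "real \<times> real \<times> real"
  have H_bound: "\<bar>H s y\<bar> \<le> B + M" if "s \<le> T" "regular y" for s y
    using f_bound[of "s - fst y"] f_bound[of "s - fst y - fst (snd y)"] r_bound[of "fst (snd y)"] that
    by (auto simp: H_def)
  have B: "0 \<le> B" using f_bound[of T] by simp
  have [measurable]: "(\<lambda>(s, y). H s y) \<in> borel_measurable (borel \<Otimes>\<^sub>M \<mu>)"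
    unfolding H_def by measurable
  have int_H: "integrable \<mu> (H s)" if "s \<le> T" for s
    by (rule mu.integrable_const_bound[where B = "B + M"])
      (use that in \<open>auto intro!: eventually_mono[OF AE_mu_regular] H_bound\<close>)
  have super: "(\<integral>y. H s y \<partial>\<mu>) \<le> f s" if "0 \<le> s" "s \<le> T" for s
  proof -
    have "(\<integral>y. H s y \<partial>\<mu>) \<le> (\<integral>y. Q s y \<partial>\<mu>)"
      by (rule integral_mono_AE[OF int_H[OF that(2)] Q_int[OF that]])
        (use AE_mu_regular in eventually_elim, unfold H_def, rule Q_ge[OF that])
    with Q_le[OF that] show ?thesis by simp
  qed
  let ?K = "\<lambda>(s, y). H s y - f s"
  let ?G = "\<lambda>(s, y). if 0 \<le> s \<and> s \<le> T then ?K (s, y) else 0"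
  have K: "?K \<in> borel_measurable (borel \<Otimes>\<^sub>M \<mu>)" by measurable
  have K_bound: "\<bar>?K (s, y)\<bar> \<le> (B + M) + B" if "0 \<le> s" "s \<le> T" "regular y" for s y
    using H_bound[of s y] f_bound[of s] that by auto
  have "(\<integral>\<omega>. drift \<pi> T f n \<omega> \<partial>\<Omega>) \<le> 0" for n
  proof -
    have "(\<integral>\<omega>. drift \<pi> T f n \<omega> \<partial>\<Omega>) \<le> (\<integral>\<omega>. ?G (remaining \<pi> T \<omega> n, \<omega> n) \<partial>\<Omega>)"
    proof (rule integral_mono_AE)
      show "integrable \<Omega> (drift \<pi> T f n)"
        by (rule integrable_drift[OF \<pi> T f f_neg f_bound])
      show "integrable \<Omega> (\<lambda>\<omega>. ?G (remaining \<pi> T \<omega> n, \<omega> n))"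
        by (rule integrable_alive_step[OF \<pi> K K_bound]) (use B M_nonneg in auto)
      show "AE \<omega> in \<Omega>. drift \<pi> T f n \<omega> \<le> ?G (remaining \<pi> T \<omega> n, \<omega> n)"
        using AE_Omega_regular
      proof eventually_elim
        case (elim \<omega>)
        \<comment> \<open>If the time left is negative, monotonicity and \<open>f_neg\<close> make
          both sides 0. Otherwise the drift is one of the two entries of the maximum, minus the old
          potential.\<close>
        have "remaining \<pi> T \<omega> n \<le> T" "remaining \<pi> T \<omega> (Suc n) \<le> remaining \<pi> T \<omega> n"
          using remaining_le remaining_antimono elim by auto
        then show ?case
          by (auto simp: drift_def step_reward_def H_def remaining_Suc So_def Xo_def f_neg of_bool_def)
      qed
    qed
    also have "\<dots> = (\<integral>\<omega>. (if 0 \<le> remaining \<pi> T \<omega> n \<and> remaining \<pi> T \<omega> n \<le> T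
            then \<integral>y. ?K (remaining \<pi> T \<omega> n, y) \<partial>\<mu> else 0) \<partial>\<Omega>)"
      by (rule integral_alive_step[OF \<pi> K K_bound]) (use B M_nonneg in auto)
    also have "\<dots> \<le> 0"
    proof -
      let ?h = "\<lambda>s. if 0 \<le> s \<and> s \<le> T then \<integral>y. ?K (s, y) \<partial>\<mu> else 0"
      have "0 \<le> (\<integral>\<omega>. - ?h (remaining \<pi> T \<omega> n) \<partial>\<Omega>)"
        by (rule integral_nonneg_AE)
          (use super in \<open>auto simp: int_H mu.prob_space Bochner_Integration.integral_diff\<close>)
      then show ?thesis by simp
    qed
    finally show ?thesis .
  qed
  then have "U l \<nu> r T \<pi> - f T \<le> 0"
    by (rule sums_le[OF _ drift_sums[OF \<pi> T f f_neg f_bound] sums_zero])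
  then show ?thesis by simp
qed

abbreviation threshold :: "real \<Rightarrow> policy" where
  "threshold c \<equiv> \<lambda>n x t h. r x \<ge> c * x"

lemma admissible_threshold: "admissible (threshold c)"
  unfolding admissible_def by measurable

text \<open>The threshold rule looks at the duration alone, so its drift agrees almost surely with a
  function of the time left and the current step; \<open>Q\<close> now bounds that function from
  below.\<close>

lemma U_threshold_ge_subsolution:
  assumes T: "0 \<le> T" and f [measurable]: "f \<in> borel_measurable borel"
    and f_neg: "\<And>s. s < 0 \<Longrightarrow> f s = 0" and f_bound: "\<And>s. s \<le> T \<Longrightarrow> \<bar>f s\<bar> \<le> B"
    and Q_int: "\<And>s. 0 \<le> s \<Longrightarrow> s \<le> T \<Longrightarrow> integrable \<mu> (Q s)"
    and Q_le: "\<And>s y. 0 \<le> s \<Longrightarrow> s \<le> T \<Longrightarrow> regular y \<Longrightarrow> Q s y \<le>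
      (if c * fst (snd y) \<le> r (fst (snd y)) then r (fst (snd y)) + f (s - fst y - fst (snd y))
       else f (s - fst y))"
    and Q_ge: "\<And>s. 0 \<le> s \<Longrightarrow> s \<le> T \<Longrightarrow> f s \<le> (\<integral>y. Q s y \<partial>\<mu>)"
  shows "f T \<le> U l \<nu> r T (threshold c)"
proof -
  note \<pi> = admissible_threshold[of c]
  define H where "H s y = (if c * fst (snd y) \<le> r (fst (snd y))
      then r (fst (snd y)) + f (s - fst y - fst (snd y)) else f (s - fst y))"
    for s and y :: "real \<times> real \<times> real"
  have H_bound: "\<bar>H s y\<bar> \<le> B + M" if "s \<le> T" "regular y" for s y
    using f_bound[of "s - fst y"] f_bound[of "s - fst y - fst (snd y)"] r_bound[of "fst (snd y)"] M_nonneg that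
    by (auto simp: H_def)
  have B: "0 \<le> B" using f_bound[of T] by simp
  have [measurable]: "(\<lambda>(s, y). H s y) \<in> borel_measurable (borel \<Otimes>\<^sub>M \<mu>)"
    unfolding H_def by measurable
  have int_H: "integrable \<mu> (H s)" if "s \<le> T" for s
    by (rule mu.integrable_const_bound[where B = "B + M"])
      (use that in \<open>auto intro!: eventually_mono[OF AE_mu_regular] H_bound\<close>)
  have sub: "f s \<le> (\<integral>y. H s y \<partial>\<mu>)" if "0 \<le> s" "s \<le> T" for s
  proof -
    have "(\<integral>y. Q s y \<partial>\<mu>) \<le> (\<integral>y. H s y \<partial>\<mu>)"
      by (rule integral_mono_AE[OF Q_int[OF that] int_H[OF that(2)]])
        (use AE_mu_regular in eventually_elim, unfold H_def, rule Q_le[OF that])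
    with Q_ge[OF that] show ?thesis by simp
  qed
  let ?K = "\<lambda>(s, y). H s y - f s"
  let ?G = "\<lambda>(s, y). if 0 \<le> s \<and> s \<le> T then ?K (s, y) else 0"
  have K: "?K \<in> borel_measurable (borel \<Otimes>\<^sub>M \<mu>)" by measurable
  have K_bound: "\<bar>?K (s, y)\<bar> \<le> (B + M) + B" if "0 \<le> s" "s \<le> T" "regular y" for s y
    using H_bound[of s y] f_bound[of s] that by auto
  have "0 \<le> (\<integral>\<omega>. drift (threshold c) T f n \<omega> \<partial>\<Omega>)" for n
  proof -
    let ?R = "\<lambda>\<omega>. remaining (threshold c) T \<omega> n"
    have "0 \<le> (\<integral>\<omega>. (if 0 \<le> ?R \<omega> \<and> ?R \<omega> \<le> T then \<integral>y. ?K (?R \<omega>, y) \<partial>\<mu> else 0) \<partial>\<Omega>)"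
      by (rule integral_nonneg_AE)
        (use sub in \<open>auto simp: int_H mu.prob_space Bochner_Integration.integral_diff\<close>)
    also have "\<dots> = (\<integral>\<omega>. ?G (?R \<omega>, \<omega> n) \<partial>\<Omega>)"
      by (rule integral_alive_step[OF \<pi> K K_bound, symmetric]) (use B M_nonneg in auto)
    also have "\<dots> \<le> (\<integral>\<omega>. drift (threshold c) T f n \<omega> \<partial>\<Omega>)"
    proof (rule integral_mono_AE)
      show "integrable \<Omega> (drift (threshold c) T f n)"
        by (rule integrable_drift[OF \<pi> T f f_neg f_bound])
      show "integrable \<Omega> (\<lambda>\<omega>. ?G (?R \<omega>, \<omega> n))"
        by (rule integrable_alive_step[OF \<pi> K K_bound]) (use B M_nonneg in auto)
      show "AE \<omega> in \<Omega>. ?G (?R \<omega>, \<omega> n) \<le> drift (threshold c) T f n \<omega>"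
        using AE_Omega_regular
      proof eventually_elim
        case (elim \<omega>)
        have act: "act (threshold c) \<omega> n \<longleftrightarrow> c * Xo \<omega> n \<le> r (Xo \<omega> n)"
          by (simp add: act_def Let_def)
        have "?R \<omega> \<le> T" "remaining (threshold c) T \<omega> (Suc n) \<le> ?R \<omega>"
          using remaining_le remaining_antimono elim by auto
        then show ?case
          by (auto simp: drift_def step_reward_def H_def act remaining_Suc So_def Xo_def f_neg of_bool_def)
      qed
    qed
    finally show ?thesis .
  qed
  then have "0 \<le> U l \<nu> r T (threshold c) - f T"
    by (rule sums_le[OF _ sums_zero drift_sums[OF \<pi> T f f_neg f_bound]])
  then show ?thesis by simp
qed

section \<open>Explicit means for the comparison integrands\<close>

lemma integrable_nu_bounded:
  assumes [measurable]: "h \<in> borel_measurable borel" and "\<And>x. x \<in> {0..C} \<Longrightarrow> \<bar>h x\<bar> \<le> (B::real)"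
  shows "integrable \<nu> (\<lambda>p. h (fst p))"
  by (rule nu.integrable_const_bound[where B = B]) (auto intro!: eventually_mono[OF X_range] assms)

text \<open>Averaging over the task first turns \<open>\<psi>\<close>, the gain of a proposal
  relative to the potential, into \<open>g / l\<close>, and
  \<open>exponential_integral_potential\<close> then restores \<open>f s\<close>. As
  \<open>\<phi>\<close> is the reward of a task proposed too late, only the sign of its mean minus
  \<open>f 0\<close> remains to be checked.\<close>

lemma has_bochner_integral_bellman:
  fixes f g \<phi> :: "real \<Rightarrow> real" and \<psi> :: "real \<Rightarrow> real \<Rightarrow> real"
  assumes s: "0 \<le> s" and N: "finite N" and cont: "continuous_on UNIV f"
    and deriv: "\<And>u. u \<notin> N \<Longrightarrow> (f has_real_derivative g u) (at u)"
    and g: "g \<in> borel_measurable borel" "\<And>u. \<bar>g u\<bar> \<le> B"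
    and \<psi> [measurable]: "(\<lambda>(u, x). \<psi> u x) \<in> borel_measurable (borel \<Otimes>\<^sub>M borel)"
    and \<psi>_bound: "\<And>u x. x \<in> {0..C} \<Longrightarrow> \<bar>\<psi> u x\<bar> \<le> K"
    and \<psi>_int: "\<And>u. 0 \<le> u \<Longrightarrow> (\<integral>p. \<psi> u (fst p) \<partial>\<nu>) = g u / l"
    and \<phi> [measurable]: "\<phi> \<in> borel_measurable borel" and \<phi>_bound: "\<And>x. x \<in> {0..C} \<Longrightarrow> \<bar>\<phi> x\<bar> \<le> K"
  shows "has_bochner_integral \<mu>
      (\<lambda>y. if fst y \<le> s then f (s - fst y) + \<psi> (s - fst y) (fst (snd y)) else \<phi> (fst (snd y)))
      (f s + exp (- l * s) * ((\<integral>p. \<phi> (fst p) \<partial>\<nu>) - f 0))"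
proof -
  define Q where "Q y = (if fst y \<le> s then f (s - fst y) + \<psi> (s - fst y) (fst (snd y))
      else \<phi> (fst (snd y)))" for y :: "real \<times> real \<times> real"
  have [measurable]: "f \<in> borel_measurable borel"
    using cont by (rule borel_measurable_continuous_onI)
  have [measurable]: "Q \<in> borel_measurable \<mu>" unfolding Q_def by measurable
  have "compact (f ` {0..s})"
    by (intro compact_continuous_image continuous_on_subset[OF cont]) auto
  then obtain B' where B': "\<And>x. x \<in> {0..s} \<Longrightarrow> \<bar>f x\<bar> \<le> B'"
    by (force dest!: compact_imp_bounded simp: bounded_iff)
  have "\<bar>Q y\<bar> \<le> \<bar>B'\<bar> + K" if "regular y" for y
    using that B'[of "s - fst y"] \<psi>_bound[of "fst (snd y)" "s - fst y"] \<phi>_bound[of "fst (snd y)"]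
    by (auto simp: Q_def)
  then have int: "integrable \<mu> Q"
    by (intro mu.integrable_const_bound[where B = "\<bar>B'\<bar> + K"])
      (auto intro!: eventually_mono[OF AE_mu_regular])
  have "(\<integral>y. Q y \<partial>\<mu>) = (\<integral>x. (\<integral>p. Q (x, p) \<partial>\<nu>) \<partial>idle)"
    using int unfolding step_measure_def by (rule idle_nu.integral_fst'[symmetric])
  also have "\<dots> = (\<integral>x. (if x \<le> s then f (s - x) + g (s - x) / l else \<integral>p. \<phi> (fst p) \<partial>\<nu>) \<partial>idle)"
  proof (rule Bochner_Integration.integral_cong[OF refl])
    fix x
    have "integrable \<nu> (\<lambda>p. \<psi> (s - x) (fst p))"
      using \<psi>_bound by (intro integrable_nu_bounded) auto
    then show "(\<integral>p. Q (x, p) \<partial>\<nu>) = (if x \<le> s then f (s - x) + g (s - x) / l else \<integral>p. \<phi> (fst p) \<partial>\<nu>)"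
      by (simp add: Q_def \<psi>_int nu.prob_space)
  qed
  also have "\<dots> = f s + exp (- l * s) * ((\<integral>p. \<phi> (fst p) \<partial>\<nu>) - f 0)"
    by (rule exponential_integral_potential[OF l_pos s N cont deriv g])
  finally have "(\<integral>y. Q y \<partial>\<mu>) = f s + exp (- l * s) * ((\<integral>p. \<phi> (fst p) \<partial>\<nu>) - f 0)" .
  with int show ?thesis unfolding has_bochner_integral_iff Q_def by simp
qed

end

section \<open>Constants attached to the root\<close>

locale task_model_root = task_model +
  fixes c :: real
  assumes c_nonneg: "0 \<le> c" and root: "Phi l \<nu> r c = 0"
begin

definition accepted_prob :: real where
  "accepted_prob = (\<integral>p. of_bool (c * fst p \<le> r (fst p)) \<partial>\<nu>)"

definition accepted_time :: real where
  "accepted_time = (\<integral>p. fst p * of_bool (c * fst p \<le> r (fst p)) \<partial>\<nu>)"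

definition accepted_reward :: real where
  "accepted_reward = (\<integral>p. r (fst p) * of_bool (c * fst p \<le> r (fst p)) \<partial>\<nu>)"

text \<open>The best mean reward of a task proposed after the horizon, when its duration no longer
  costs anything.\<close>

definition greedy_reward :: real where
  "greedy_reward = (\<integral>p. max (r (fst p)) 0 \<partial>\<nu>)"

lemma integrable_accepted:
  "integrable \<nu> (\<lambda>p. of_bool (c * fst p \<le> r (fst p)) :: real)"
  "integrable \<nu> (\<lambda>p. fst p * of_bool (c * fst p \<le> r (fst p)))"
  "integrable \<nu> (\<lambda>p. r (fst p) * of_bool (c * fst p \<le> r (fst p)))"
  "integrable \<nu> (\<lambda>p. max (r (fst p)) 0)"
proof -
  show "integrable \<nu> (\<lambda>p. of_bool (c * fst p \<le> r (fst p)) :: real)"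
    by (rule integrable_nu_bounded[of "\<lambda>x. of_bool (c * x \<le> r x)" 1]) auto
  show "integrable \<nu> (\<lambda>p. fst p * of_bool (c * fst p \<le> r (fst p)))"
    by (rule integrable_nu_bounded[of "\<lambda>x. x * of_bool (c * x \<le> r x)" C]) (use C_pos in auto)
  show "integrable \<nu> (\<lambda>p. r (fst p) * of_bool (c * fst p \<le> r (fst p)))"
    by (rule integrable_nu_bounded[of "\<lambda>x. r x * of_bool (c * x \<le> r x)" M])
      (use r_bound M_nonneg in auto)
  show "integrable \<nu> (\<lambda>p. max (r (fst p)) 0)"
    by (rule integrable_nu_bounded[of "\<lambda>x. max (r x) 0" M])
      (use r_bound M_nonneg in \<open>auto simp: max_def abs_le_iff\<close>)
qed

text \<open>The root equation in the form needed for a potential of slope \<open>c\<close>: the mean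
  gain of a proposal equals slope over \<open>l\<close>.\<close>

lemma integral_excess: "(\<integral>p. max (r (fst p) - c * fst p) 0 \<partial>\<nu>) = c / l"
  using root l_pos by (simp add: Phi_def field_simps)

text \<open>The positive part of r(X) - c X is that difference times the acceptance indicator. This
  relation later determines the slope below \<open>C\<close>.\<close>

lemma accepted_reward_eq: "accepted_reward = c / l + c * accepted_time"
proof -
  have "c / l = (\<integral>p. r (fst p) * of_bool (c * fst p \<le> r (fst p))
      - c * (fst p * of_bool (c * fst p \<le> r (fst p))) \<partial>\<nu>)"
    unfolding integral_excess[symmetric]
    by (rule Bochner_Integration.integral_cong) (auto simp: max_def)
  also have "\<dots> = accepted_reward - c * accepted_time"
    unfolding accepted_reward_def accepted_time_def using integrable_accepted by simp
  finally show ?thesis by simp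
qed

lemma accepted_prob_bounds: "0 \<le> accepted_prob" "accepted_prob \<le> 1"
proof -
  show "0 \<le> accepted_prob" unfolding accepted_prob_def by (rule integral_nonneg_AE) simp
  have "accepted_prob \<le> (\<integral>p. 1 \<partial>\<nu>)"
    unfolding accepted_prob_def by (rule integral_mono[OF integrable_accepted(1)]) auto
  then show "accepted_prob \<le> 1" by (simp add: nu.prob_space)
qed

lemma accepted_reward_nonneg: "0 \<le> accepted_reward"
  unfolding accepted_reward_def
proof (rule integral_nonneg_AE)
  show "AE p in \<nu>. 0 \<le> r (fst p) * of_bool (c * fst p \<le> r (fst p))"
    using X_range
  proof eventually_elim
    case (elim p)
    then have "0 \<le> c * fst p" using c_nonneg by simp
    then show ?case by auto
  qed
qed

text \<open>Accepted rewards are already nonnegative, and a rejected one is below c X \<le> c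
  C.\<close>

lemma greedy_reward_le: "greedy_reward \<le> accepted_reward + c * C * (1 - accepted_prob)"
proof -
  have "greedy_reward \<le> (\<integral>p. r (fst p) * of_bool (c * fst p \<le> r (fst p))
      + c * C * (1 - of_bool (c * fst p \<le> r (fst p))) \<partial>\<nu>)"
    unfolding greedy_reward_def
  proof (rule integral_mono_AE)
    show "AE p in \<nu>. max (r (fst p)) 0 \<le> r (fst p) * of_bool (c * fst p \<le> r (fst p))
      + c * C * (1 - of_bool (c * fst p \<le> r (fst p)))"
      using X_range
    proof eventually_elim
      case (elim p)
      then have "0 \<le> c * fst p" "c * fst p \<le> c * C"
        using c_nonneg by (auto intro: mult_left_mono)
      then show ?case by auto
    qed
  qed (use integrable_accepted in auto)
  also have "\<dots> = accepted_reward + c * C * (1 - accepted_prob)"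
    unfolding accepted_reward_def accepted_prob_def using integrable_accepted by (simp add: nu.prob_space)
  finally show ?thesis .
qed

lemma excess_bound:
  assumes "x \<in> {0..C}"
  shows "\<bar>max (r x - c * x) 0\<bar> \<le> M"
proof -
  have "0 \<le> c * x" using assms c_nonneg by simp
  then show ?thesis using r_bound[OF assms] by auto
qed

lemma positive_part_bound: "x \<in> {0..C} \<Longrightarrow> \<bar>max (r x) 0\<bar> \<le> M"
  using r_bound[of x] by auto

section \<open>The explicit comparison functions\<close>

text \<open>The offset \<open>b\<close> has two tasks. Being at least \<open>greedy_reward\<close>,
  it makes the late-proposal term nonpositive. Being at least \<open>c * C\<close>, it covers an
  overrun: with u left after the idle time, r(x) \<le> c x + (excess of x) \<le> b + c u + (excess
  of x).\<close>

lemma U_le: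
  assumes \<pi>: "admissible \<pi>" and T: "0 \<le> T"
  shows "U l \<nu> r T \<pi> \<le> c * T + max greedy_reward (c * C)"
proof -
  define b where "b = max greedy_reward (c * C)"
  have b: "0 \<le> b" "c * C \<le> b" "greedy_reward \<le> b"
    using c_nonneg C_pos by (auto simp: b_def intro: order_trans[of 0 "c * C"])
  define f where "f s = (if s < 0 then 0 else c * s + b)" for s
  define Q where "Q s y = (if fst y \<le> s then (c * (s - fst y) + b) + max (r (fst (snd y)) - c * fst (snd y)) 0
      else max (r (fst (snd y))) 0)" for s and y :: "real \<times> real \<times> real"
  have Q: "has_bochner_integral \<mu> (Q s)
      ((c * s + b) + exp (- l * s) * ((\<integral>p. max (r (fst p)) 0 \<partial>\<nu>) - (c * 0 + b)))" if "0 \<le> s" for s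
    unfolding Q_def
    by (rule has_bochner_integral_bellman[OF that, where g = "\<lambda>_. c" and N = "{}" and B = "\<bar>c\<bar>" and K = M
        and f = "\<lambda>u. c * u + b" and \<psi> = "\<lambda>u x. max (r x - c * x) 0" and \<phi> = "\<lambda>x. max (r x) 0"])
      (use excess_bound positive_part_bound in
        \<open>auto intro!: continuous_intros derivative_eq_intros simp: integral_excess\<close>)
  have "U l \<nu> r T \<pi> \<le> f T"
  proof (rule U_le_supersolution[OF \<pi> T])
    show "f \<in> borel_measurable borel" unfolding f_def by measurable
    show "f s = 0" if "s < 0" for s using that by (simp add: f_def)
    show "\<bar>f s\<bar> \<le> c * T + b" if "s \<le> T" for s
      using b mult_left_mono[OF that c_nonneg] mult_nonneg_nonneg[OF c_nonneg, of s] T c_nonneg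
      by (auto simp: f_def)
    show "integrable \<mu> (Q s)" if "0 \<le> s" for s using Q[OF that] by (simp add: has_bochner_integral_iff)
    show "(\<integral>y. Q s y \<partial>\<mu>) \<le> f s" if "0 \<le> s" for s
      unfolding has_bochner_integral_integral_eq[OF Q[OF that]] using that b by (simp add: f_def greedy_reward_def[symmetric] mult_nonneg_nonpos)
    show "max (f (s - fst y)) (r (fst (snd y)) + f (s - fst y - fst (snd y))) \<le> Q s y"
      if "regular y" for s y
    proof -
      have "c * fst (snd y) \<le> c * C" "0 \<le> c * fst (snd y)"
        using c_nonneg that by (auto intro: mult_left_mono)
      moreover have "0 \<le> c * (s - fst y)" if "fst y \<le> s" using that c_nonneg by simp
      ultimately show ?thesis using b that by (auto simp: f_def Q_def algebra_simps)
    qed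
  qed
  then show ?thesis using T by (simp add: f_def b_def)
qed

text \<open>Without a jump at 0 an overrun only helps, since the linear continuation would be
  negative there; the late-proposal term is the nonnegative \<open>accepted_reward\<close>.\<close>

lemma U_threshold_ge_time:
  assumes T: "0 \<le> T"
  shows "c * T \<le> U l \<nu> r T (threshold c)"
proof -
  define f where "f s = (if s < 0 then 0 else c * s)" for s
  define \<phi> where "\<phi> x = r x * of_bool (c * x \<le> r x)" for x
  define Q where "Q s y = (if fst y \<le> s then c * (s - fst y) + max (r (fst (snd y)) - c * fst (snd y)) 0
      else \<phi> (fst (snd y)))" for s and y :: "real \<times> real \<times> real"
  have [measurable]: "\<phi> \<in> borel_measurable borel" unfolding \<phi>_def by measurable
  have \<phi>_bound: "\<bar>\<phi> x\<bar> \<le> M" if "x \<in> {0..C}" for x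
    using r_bound[OF that] by (auto simp: \<phi>_def)
  have Q: "has_bochner_integral \<mu> (Q s)
      (c * s + exp (- l * s) * ((\<integral>p. \<phi> (fst p) \<partial>\<nu>) - c * 0))" if "0 \<le> s" for s
    unfolding Q_def
    by (rule has_bochner_integral_bellman[OF that, where g = "\<lambda>_. c" and N = "{}" and B = "\<bar>c\<bar>" and K = M
        and f = "\<lambda>u. c * u" and \<psi> = "\<lambda>u x. max (r x - c * x) 0" and \<phi> = \<phi>])
      (use excess_bound \<phi>_bound in
        \<open>auto intro!: continuous_intros derivative_eq_intros simp: integral_excess\<close>)
  have "f T \<le> U l \<nu> r T (threshold c)"
  proof (rule U_threshold_ge_subsolution[OF T])
    show "f \<in> borel_measurable borel" unfolding f_def by measurable
    show "f s = 0" if "s < 0" for s using that by (simp add: f_def)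
    show "\<bar>f s\<bar> \<le> c * T" if "s \<le> T" for s
      using mult_left_mono[OF that c_nonneg] mult_nonneg_nonneg[OF c_nonneg, of s] T c_nonneg
      by (auto simp: f_def)
    show "integrable \<mu> (Q s)" if "0 \<le> s" for s using Q[OF that] by (simp add: has_bochner_integral_iff)
    show "f s \<le> (\<integral>y. Q s y \<partial>\<mu>)" if "0 \<le> s" for s
      unfolding has_bochner_integral_integral_eq[OF Q[OF that]] using that accepted_reward_nonneg
      by (simp add: f_def \<phi>_def accepted_reward_def[symmetric])
    show "Q s y \<le> (if c * fst (snd y) \<le> r (fst (snd y)) then r (fst (snd y)) + f (s - fst y - fst (snd y))
       else f (s - fst y))" if "regular y" for s y
    proof -
      have "0 \<le> c * fst (snd y)" using c_nonneg that by simp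
      moreover have "c * (s - fst y - fst (snd y)) \<le> 0" if "s - fst y - fst (snd y) < 0"
        using that c_nonneg by (simp add: mult_nonneg_nonpos)
      ultimately show ?thesis using that by (auto simp: f_def Q_def \<phi>_def algebra_simps)
    qed
  qed
  then show ?thesis using T by (simp add: f_def)
qed

text \<open>Taking F(0) = \<open>accepted_reward\<close> makes the late-proposal term vanish
  exactly. An overrun now forfeits this value, but durations are at most \<open>C\<close>, so that
  happens only with less than \<open>C\<close> left; there the potential gets a smaller
  slope.\<close>

lemma U_threshold_ge_reward:
  assumes T: "0 \<le> T"
  shows "c * T + accepted_reward - c * accepted_prob * C \<le> U l \<nu> r T (threshold c)"
proof -
  define b where "b = accepted_reward"
  \<comment> \<open>The slope d = c - \<kappa> below \<open>C\<close> must satisfy d / l = b (1 -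
    P(A)) - d E[X; A]. Since b = c (1 / l + E[X; A]), this gives d = c (1 - P(A)).\<close>
  define \<kappa> where "\<kappa> = c * accepted_prob"
  define F where "F s = c * s + b - \<kappa> * min s C" for s
  define f where "f s = (if s < 0 then 0 else F s)" for s
  define g where "g u = (if u < C then c - \<kappa> else c)" for u
  define \<phi> where "\<phi> x = r x * of_bool (c * x \<le> r x)" for x
  \<comment> \<open>A bound for the drop of potential caused by accepting x with u left. It is
    affine in x, so its mean over accepted tasks involves only \<open>accepted_time\<close> and
    \<open>accepted_prob\<close>. Below \<open>C\<close> it charges \<open>b\<close> as if every
    accepted task overran.\<close>
  define loss where "loss u x = (if u < C then (c - \<kappa>) * x + b else c * x)" for u x
  define \<psi> where "\<psi> u x = (r x - loss u x) * of_bool (c * x \<le> r x)" for u x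
  define Q where "Q s y = (if fst y \<le> s then F (s - fst y) + \<psi> (s - fst y) (fst (snd y))
      else \<phi> (fst (snd y)))" for s and y :: "real \<times> real \<times> real"
  have b: "0 \<le> b" unfolding b_def by (rule accepted_reward_nonneg)
  have \<kappa>: "0 \<le> \<kappa>" "\<kappa> \<le> c"
    using accepted_prob_bounds c_nonneg by (auto simp: \<kappa>_def mult_left_le)
  have [measurable]: "\<phi> \<in> borel_measurable borel" unfolding \<phi>_def by measurable
  have \<psi>_meas: "(\<lambda>(u, x). \<psi> u x) \<in> borel_measurable (borel \<Otimes>\<^sub>M borel)"
    unfolding \<psi>_def loss_def by measurable
  have loss_bound: "0 \<le> loss u x" "loss u x \<le> c * C + b" if "x \<in> {0..C}" for u x
  proof -
    have "0 \<le> (c - \<kappa>) * x" "(c - \<kappa>) * x \<le> c * C" "0 \<le> c * x" "c * x \<le> c * C"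
      using that \<kappa> c_nonneg by (auto intro: mult_mono)
    then show "0 \<le> loss u x" "loss u x \<le> c * C + b" using b by (auto simp: loss_def)
  qed
  have bounds: "\<bar>\<phi> x\<bar> \<le> M + (c * C + b)" "\<bar>\<psi> u x\<bar> \<le> M + (c * C + b)" if "x \<in> {0..C}" for u x
    using r_bound[OF that] loss_bound[OF that, of u] by (auto simp: \<phi>_def \<psi>_def)
  have \<psi>_int: "(\<integral>p. \<psi> u (fst p) \<partial>\<nu>) = g u / l" for u
  proof (cases "u < C")
    case True
    have "(\<integral>p. \<psi> u (fst p) \<partial>\<nu>) = (\<integral>p. r (fst p) * of_bool (c * fst p \<le> r (fst p))
        - (c - \<kappa>) * (fst p * of_bool (c * fst p \<le> r (fst p)))
        - b * of_bool (c * fst p \<le> r (fst p)) \<partial>\<nu>)"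
      using True by (intro Bochner_Integration.integral_cong) (auto simp: \<psi>_def loss_def)
    also have "\<dots> = accepted_reward - (c - \<kappa>) * accepted_time - b * accepted_prob"
      unfolding accepted_reward_def accepted_time_def accepted_prob_def using integrable_accepted by simp
    also have "\<dots> = (c - \<kappa>) / l"
      unfolding b_def \<kappa>_def accepted_reward_eq using l_pos by (simp add: field_simps)
    finally show ?thesis using True by (simp add: g_def)
  next
    case False
    then have "\<psi> u x = max (r x - c * x) 0" for x by (auto simp: \<psi>_def loss_def)
    then show ?thesis using False integral_excess by (simp add: g_def)
  qed
  have deriv: "(F has_real_derivative g u) (at u)" if "u \<notin> {C}" for u
  proof (cases "u < C")
    case True
    have "((\<lambda>u. c * u + b - \<kappa> * u) has_real_derivative g u) (at u)"
      using True by (auto intro!: derivative_eq_intros simp: g_def)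
    then show ?thesis
      by (rule has_field_derivative_transform_within_open[of _ _ _ "{..<C}"]) (use True in \<open>auto simp: F_def\<close>)
  next
    case False
    have "((\<lambda>u. c * u + b - \<kappa> * C) has_real_derivative g u) (at u)"
      using False by (auto intro!: derivative_eq_intros simp: g_def)
    then show ?thesis
      by (rule has_field_derivative_transform_within_open[of _ _ _ "{C<..}"])
        (use False that in \<open>auto simp: F_def\<close>)
  qed
  have cont: "continuous_on UNIV F" unfolding F_def by (intro continuous_intros)
  have g: "g \<in> borel_measurable borel" unfolding g_def by measurable
  have g_bound: "\<bar>g u\<bar> \<le> c" for u
    using \<kappa> c_nonneg by (auto simp: g_def)
  have Q: "has_bochner_integral \<mu> (Q s) (F s + exp (- l * s) * ((\<integral>p. \<phi> (fst p) \<partial>\<nu>) - F 0))"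
    if "0 \<le> s" for s
    unfolding Q_def
    by (rule has_bochner_integral_bellman[where N = "{C}", OF that _ cont deriv g g_bound \<psi>_meas bounds(2) \<psi>_int _ bounds(1)]) simp_all
  have F_bounds: "0 \<le> F s" "F s \<le> c * T + b" if "0 \<le> s" "s \<le> T" for s
  proof -
    have "\<kappa> * min s C \<le> c * s" using that \<kappa> C_pos by (intro mult_mono) auto
    moreover have "0 \<le> \<kappa> * min s C" "c * s \<le> c * T"
      using that \<kappa> c_nonneg C_pos by (auto intro: mult_left_mono)
    ultimately show "0 \<le> F s" "F s \<le> c * T + b" using b by (auto simp: F_def)
  qed
  have "f T \<le> U l \<nu> r T (threshold c)"
  proof (rule U_threshold_ge_subsolution[OF T])
    show "f \<in> borel_measurable borel" unfolding f_def F_def by measurable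
    show "f s = 0" if "s < 0" for s using that by (simp add: f_def)
    show "\<bar>f s\<bar> \<le> c * T + b" if "s \<le> T" for s
      using F_bounds[OF _ that] b c_nonneg T by (auto simp: f_def)
    show "integrable \<mu> (Q s)" if "0 \<le> s" for s using Q[OF that] by (simp add: has_bochner_integral_iff)
    show "f s \<le> (\<integral>y. Q s y \<partial>\<mu>)" if "0 \<le> s" for s
      unfolding has_bochner_integral_integral_eq[OF Q[OF that]] using that C_pos
      by (simp add: f_def F_def \<phi>_def b_def accepted_reward_def[symmetric])
    show "Q s y \<le> (if c * fst (snd y) \<le> r (fst (snd y)) then r (fst (snd y)) + f (s - fst y - fst (snd y))
       else f (s - fst y))" if "regular y" for s y
    proof -
      \<comment> \<open>For u < C, both a fitting task and an overrun cost at most (c - \<kappa>) x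
        + b. For u \<ge> C every task fits, and the flatter part of \<open>F\<close> only reduces
        the drop below c x.\<close>
      have key: "F u - f (u - x) \<le> loss u x" if u: "0 \<le> u" and x: "x \<in> {0..C}" for u x
      proof -
        have "0 \<le> \<kappa> * (C - min (u - x) C)" using \<kappa> by simp
        moreover have "(c - \<kappa>) * u \<le> (c - \<kappa>) * x" if "u < x" using that \<kappa> by (intro mult_left_mono) auto
        ultimately show ?thesis using u x b \<kappa> by (auto simp: f_def F_def loss_def algebra_simps min_def)
      qed
      show ?thesis
        using key[of "s - fst y" "fst (snd y)"] that
        by (auto simp: Q_def \<psi>_def \<phi>_def f_def)
    qed
  qed
  moreover have "\<kappa> * min T C \<le> \<kappa> * C" using \<kappa> by (intro mult_left_mono) auto
  ultimately show ?thesis using T by (simp add: f_def F_def b_def \<kappa>_def)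
qed

end

theorem theorem2p2:
  fixes l C E D T cstar :: real
    and \<nu> :: "(real \<times> real) measure"
    and r :: "real \<Rightarrow> real"
  assumes l_pos: "0 < l"
    and C_pos: "0 < C"
    and T_pos: "0 < T"
    and ED: "E \<le> 0" "0 \<le> D"
    and nu_prob: "prob_space \<nu>"
    and nu_sets: "sets \<nu> = sets (borel \<Otimes>\<^sub>M borel)"
    and X_range: "AE p in \<nu>. fst p \<in> {0..C}"
    and r_meas: "r \<in> borel_measurable borel"
    and r_range: "\<forall>x\<in>{0..C}. E \<le> r x \<and> r x \<le> D"
    and Y_int: "integrable \<nu> snd"
    and Y_condexp: "\<forall>A\<in>sets borel.
        (\<integral>p. indicator A (fst p) * snd p \<partial>\<nu>) = (\<integral>p. indicator A (fst p) * r (fst p) \<partial>\<nu>)"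
    and cstar_root: "0 \<le> cstar" "Phi l \<nu> r cstar = 0"
  shows "\<forall>\<pi>. admissible \<pi> \<longrightarrow>
           U l \<nu> r T (\<lambda>n x t h. r x \<ge> cstar * x) \<ge> U l \<nu> r T \<pi> - cstar * C"
proof (intro allI impI)
  fix \<pi> :: policy
  assume \<pi>: "admissible \<pi>"
  interpret task_model_root l C "max \<bar>E\<bar> \<bar>D\<bar>" \<nu> r cstar
  proof (intro task_model_root.intro task_model.intro task_model_root_axioms.intro)
    show "\<bar>r x\<bar> \<le> max \<bar>E\<bar> \<bar>D\<bar>" if "x \<in> {0..C}" for x
      using r_range[rule_format, OF that] ED by auto
  qed (fact assms)+
  \<comment> \<open>When \<open>greedy_reward\<close> is the larger offset,
    \<open>greedy_reward_le\<close> costs c C (1 - P(A)) and the flattened potential costs c C P(A),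
    which add up to exactly c C.\<close>
  show "U l \<nu> r T (\<lambda>n x t h. r x \<ge> cstar * x) \<ge> U l \<nu> r T \<pi> - cstar * C"
    using U_le[OF \<pi>, of T] U_threshold_ge_time[of T] U_threshold_ge_reward[of T] greedy_reward_le T_pos
    by (auto simp: algebra_simps max_def split: if_splits)
qed

end
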